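(* Let $\mathbf{V}$ be a nontrivial variety of groups and let $n \geq 1$. Let $F_n(\mathbf{V})$ be the relatively free group in $\mathbf{V}$ on a set of cardinality $n$. Then: (i) if $\mathbf{V}$ is periodic, then $\mathrm{rk}_S(F_n(\mathbf{V})) = \mathrm{rk}_G(F_n(\mathbf{V})) = n$; (ii) if $\mathbb{Z} \in \mathbf{V}$, then $\mathrm{rk}_S(F_n(\mathbf{V})) = \mathrm{rk}_G(F_n(\mathbf{V})) + 1 = n+1$.
   Context: A variety of groups is a class of groups defined by a set of identities; it is nontrivial if it contains a nontrivial group. It is called periodic if it satisfies some identity $x^k=1$ with $k\geq 1$ (a variety is either periodic or contains the additive group $\mathbb{Z}$). For a subset $X$ of a group $G$, $X^+$ denotes the subsemigroup of $G$ generated by $X$ (all products of one or more elements of $X$) and $\langle X\rangle$ the subgroup generated by $X$. For a finitely generated group $G$, the semigroup rank is $\mathrm{rk}_S(G)=\min\{|X| : X\subseteq G,\ X^+=G\}$ and the group rank is $\mathrm{rk}_G(G)=\min\{|X| : X\subseteq G,\ \langle X\rangle=G\}$. *)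

theory Defs
  imports "HOL-Algebra.Elementary_Groups" "HOL-Library.Countable_Set"
begin

section \<open>Group words, identities, varieties\<close>

datatype 'x gword =
    Var 'x
  | One
  | Mul "'x gword" "'x gword"
  | Inv "'x gword"

primrec gval :: "('a, 'b) monoid_scheme \<Rightarrow> ('x \<Rightarrow> 'a) \<Rightarrow> 'x gword \<Rightarrow> 'a" where
  "gval G \<phi> (Var x) = \<phi> x"
| "gval G \<phi> One = \<one>\<^bsub>G\<^esub>"
| "gval G \<phi> (Mul s t) = gval G \<phi> s \<otimes>\<^bsub>G\<^esub> gval G \<phi> t"
| "gval G \<phi> (Inv t) = inv\<^bsub>G\<^esub> (gval G \<phi> t)"

primrec gsubst :: "('x \<Rightarrow> 'y gword) \<Rightarrow> 'x gword \<Rightarrow> 'y gword" where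
  "gsubst \<sigma> (Var x) = \<sigma> x"
| "gsubst \<sigma> One = One"
| "gsubst \<sigma> (Mul s t) = Mul (gsubst \<sigma> s) (gsubst \<sigma> t)"
| "gsubst \<sigma> (Inv t) = Inv (gsubst \<sigma> t)"

text \<open>A pair \<open>(s, t)\<close> stands for the identity \<open>s = t\<close>. A set of identities may be infinite, but
  each identity involves only finitely many variables, so countably many variables suffice.\<close>

type_synonym identity = "nat gword \<times> nat gword"

definition satisfies :: "('a, 'b) monoid_scheme \<Rightarrow> identity \<Rightarrow> bool" where
  "satisfies G e \<longleftrightarrow> (\<forall>\<phi>. range \<phi> \<subseteq> carrier G \<longrightarrow> gval G \<phi> (fst e) = gval G \<phi> (snd e))"

text \<open>The variety defined by \<open>E\<close> is a proper class; \<open>variety E\<close> is polymorphic in the type of the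
  group elements and gives the members of that class over each type.\<close>

definition variety :: "identity set \<Rightarrow> ('a, 'b) monoid_scheme set" where
  "variety E = {G. group G \<and> (\<forall>e\<in>E. satisfies G e)}"

text \<open>A definition cannot quantify over all types, so the identity \<open>x ^ k = 1\<close> is required of the
  groups of the variety whose elements are natural numbers. This is no restriction, because the
  identity can be tested on cyclic subgroups, which are countable: see \<open>periodic_exponent\<close>.\<close>

definition periodic :: "identity set \<Rightarrow> bool" where
  "periodic E \<longleftrightarrow>
    (\<exists>k\<ge>1. \<forall>G \<in> (variety E :: nat monoid set). \<forall>x\<in>carrier G. x [^]\<^bsub>G\<^esub> (k::nat) = \<one>\<^bsub>G\<^esub>)"


section \<open>Relatively free groups\<close>

definition gwords :: "'x set \<Rightarrow> 'x gword set" where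
  "gwords X = {t. set_gword t \<subseteq> X}"

text \<open>The least congruence on the words over \<open>X\<close> that contains the group axioms and all
  substitution instances of the identities in \<open>E\<close>. The remaining group axioms follow from the
  ones listed.\<close>

inductive_set free_rel :: "identity set \<Rightarrow> 'x set \<Rightarrow> ('x gword \<times> 'x gword) set"
  for E :: "identity set" and X :: "'x set" where
  refl: "t \<in> gwords X \<Longrightarrow> (t, t) \<in> free_rel E X"
| sym: "(s, t) \<in> free_rel E X \<Longrightarrow> (t, s) \<in> free_rel E X"
| trans: "(s, t) \<in> free_rel E X \<Longrightarrow> (t, u) \<in> free_rel E X \<Longrightarrow> (s, u) \<in> free_rel E X"
| mul: "(s, s') \<in> free_rel E X \<Longrightarrow> (t, t') \<in> free_rel E X
    \<Longrightarrow> (Mul s t, Mul s' t') \<in> free_rel E X"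
| inv: "(s, t) \<in> free_rel E X \<Longrightarrow> (Inv s, Inv t) \<in> free_rel E X"
| assoc: "s \<in> gwords X \<Longrightarrow> t \<in> gwords X \<Longrightarrow> u \<in> gwords X
    \<Longrightarrow> (Mul (Mul s t) u, Mul s (Mul t u)) \<in> free_rel E X"
| l_one: "t \<in> gwords X \<Longrightarrow> (Mul One t, t) \<in> free_rel E X"
| l_inv: "t \<in> gwords X \<Longrightarrow> (Mul (Inv t) t, One) \<in> free_rel E X"
| ident: "(s, t) \<in> E \<Longrightarrow> range \<sigma> \<subseteq> gwords X \<Longrightarrow> (gsubst \<sigma> s, gsubst \<sigma> t) \<in> free_rel E X"

text \<open>The relatively free group on \<open>X\<close>; the lemmas \<open>rel_free_in_variety\<close>, \<open>rel_free_generated\<close>,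
  \<open>rel_free_universal\<close> and \<open>rel_free_gen_inj\<close> below show that it has the defining properties.\<close>

definition rel_free_group :: "identity set \<Rightarrow> 'x set \<Rightarrow> 'x gword set monoid" where
  "rel_free_group E X =
    \<lparr>carrier = gwords X // free_rel E X,
     mult = (\<lambda>A B. \<Union>s\<in>A. \<Union>t\<in>B. free_rel E X `` {Mul s t}),
     one = free_rel E X `` {One}\<rparr>"

definition rel_free_gen :: "identity set \<Rightarrow> 'x set \<Rightarrow> 'x \<Rightarrow> 'x gword set" where
  "rel_free_gen E X x = free_rel E X `` {Var x}"


section \<open>Semigroup rank and group rank\<close>

inductive_set semigroup_generate :: "('a, 'b) monoid_scheme \<Rightarrow> 'a set \<Rightarrow> 'a set"
  for G and Y where
  incl: "y \<in> Y \<Longrightarrow> y \<in> semigroup_generate G Y"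
| mult: "x \<in> semigroup_generate G Y \<Longrightarrow> y \<in> semigroup_generate G Y
    \<Longrightarrow> x \<otimes>\<^bsub>G\<^esub> y \<in> semigroup_generate G Y"

text \<open>The ranks are meaningful for finitely generated groups only: otherwise no number satisfies
  the condition.\<close>

definition semigroup_rank :: "('a, 'b) monoid_scheme \<Rightarrow> nat" where
  "semigroup_rank G = (LEAST m. \<exists>Y. Y \<subseteq> carrier G \<and> finite Y \<and> card Y = m
    \<and> semigroup_generate G Y = carrier G)"

definition group_rank :: "('a, 'b) monoid_scheme \<Rightarrow> nat" where
  "group_rank G = (LEAST m. \<exists>Y. Y \<subseteq> carrier G \<and> finite Y \<and> card Y = m
    \<and> generate G Y = carrier G)"


section \<open>Adequacy of the definitions\<close>

subsection \<open>The relatively free group\<close>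

lemma gwords_simps [simp]:
  "Var x \<in> gwords X \<longleftrightarrow> x \<in> X"
  "One \<in> gwords X"
  "Mul s t \<in> gwords X \<longleftrightarrow> s \<in> gwords X \<and> t \<in> gwords X"
  "Inv t \<in> gwords X \<longleftrightarrow> t \<in> gwords X"
  by (auto simp: gwords_def)

lemma gsubst_gwords: "range \<sigma> \<subseteq> gwords X \<Longrightarrow> gsubst \<sigma> t \<in> gwords X"
  by (induction t) auto

lemma free_rel_gwords: "(s, t) \<in> free_rel E X \<Longrightarrow> s \<in> gwords X \<and> t \<in> gwords X"
  by (induction rule: free_rel.induct) (auto simp: gsubst_gwords)

lemma equiv_free_rel: "equiv (gwords X) (free_rel E X)"
  by (intro equivI refl_onI symI transI subsetI)
     (auto dest: free_rel_gwords intro: free_rel.refl free_rel.sym free_rel.trans)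

lemma rel_free_class_eq:
  assumes "s \<in> gwords X" "t \<in> gwords X"
  shows "free_rel E X `` {s} = free_rel E X `` {t} \<longleftrightarrow> (s, t) \<in> free_rel E X"
  using eq_equiv_class_iff[OF equiv_free_rel assms] .

lemma rel_free_carrierE:
  assumes "A \<in> carrier (rel_free_group E X)"
  obtains t where "t \<in> gwords X" "A = free_rel E X `` {t}"
  using assms by (auto simp: rel_free_group_def elim: quotientE)

lemma rel_free_class_in: "t \<in> gwords X \<Longrightarrow> free_rel E X `` {t} \<in> carrier (rel_free_group E X)"
  by (auto simp: rel_free_group_def quotientI)

lemma rel_free_one: "\<one>\<^bsub>rel_free_group E X\<^esub> = free_rel E X `` {One}"
  by (simp add: rel_free_group_def)

lemma rel_free_mult:
  assumes s: "s \<in> gwords X" and t: "t \<in> gwords X"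
  shows "free_rel E X `` {s} \<otimes>\<^bsub>rel_free_group E X\<^esub> free_rel E X `` {t} = free_rel E X `` {Mul s t}"
proof -
  let ?R = "free_rel E X"
  have "?R `` {Mul a b} = ?R `` {Mul s t}" if "a \<in> ?R `` {s}" "b \<in> ?R `` {t}" for a b
  proof -
    have "(Mul s t, Mul a b) \<in> ?R" using that by (simp add: free_rel.mul)
    then show ?thesis using equiv_class_eq[OF equiv_free_rel] by metis
  qed
  moreover have "s \<in> ?R `` {s}" "t \<in> ?R `` {t}"
    using s t by (simp_all add: free_rel.refl)
  ultimately have "(\<Union>a\<in>?R `` {s}. \<Union>b\<in>?R `` {t}. ?R `` {Mul a b}) = ?R `` {Mul s t}"
    by blast
  then show ?thesis by (simp add: rel_free_group_def)
qed

lemma rel_free_is_group: "group (rel_free_group E X)"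
proof (rule groupI)
  let ?F = "rel_free_group E X"
  show "\<one>\<^bsub>?F\<^esub> \<in> carrier ?F"
    by (simp add: rel_free_one rel_free_class_in)
  fix A assume "A \<in> carrier ?F"
  then obtain a where a: "a \<in> gwords X" "A = free_rel E X `` {a}" by (rule rel_free_carrierE)
  show "\<one>\<^bsub>?F\<^esub> \<otimes>\<^bsub>?F\<^esub> A = A"
    using a by (simp add: rel_free_one rel_free_mult rel_free_class_eq free_rel.l_one)
  have "free_rel E X `` {Inv a} \<otimes>\<^bsub>?F\<^esub> A = \<one>\<^bsub>?F\<^esub>"
    using a by (simp add: rel_free_one rel_free_mult rel_free_class_eq free_rel.l_inv)
  then show "\<exists>B\<in>carrier ?F. B \<otimes>\<^bsub>?F\<^esub> A = \<one>\<^bsub>?F\<^esub>"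
    using a by (meson gwords_simps(4) rel_free_class_in)
  fix B assume "B \<in> carrier ?F"
  then obtain b where b: "b \<in> gwords X" "B = free_rel E X `` {b}" by (rule rel_free_carrierE)
  show "A \<otimes>\<^bsub>?F\<^esub> B \<in> carrier ?F"
    using a b by (simp add: rel_free_mult rel_free_class_in)
  fix C assume "C \<in> carrier ?F"
  then obtain c where c: "c \<in> gwords X" "C = free_rel E X `` {c}" by (rule rel_free_carrierE)
  show "A \<otimes>\<^bsub>?F\<^esub> B \<otimes>\<^bsub>?F\<^esub> C = A \<otimes>\<^bsub>?F\<^esub> (B \<otimes>\<^bsub>?F\<^esub> C)"
    using a b c by (simp add: rel_free_mult rel_free_class_eq free_rel.assoc)
qed

lemma rel_free_inv:
  assumes "t \<in> gwords X"
  shows "inv\<^bsub>rel_free_group E X\<^esub> (free_rel E X `` {t}) = free_rel E X `` {Inv t}"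
  using assms
  by (intro group.inv_equality[OF rel_free_is_group])
     (simp_all add: rel_free_one rel_free_mult rel_free_class_eq rel_free_class_in free_rel.l_inv)

lemma rel_free_gval:
  assumes "range \<sigma> \<subseteq> gwords X"
  shows "gval (rel_free_group E X) (\<lambda>i. free_rel E X `` {\<sigma> i}) t = free_rel E X `` {gsubst \<sigma> t}"
  using assms by (induction t) (simp_all add: rel_free_one rel_free_mult rel_free_inv gsubst_gwords)

theorem rel_free_in_variety: "rel_free_group E X \<in> variety E"
proof -
  let ?F = "rel_free_group E X"
  have "gval ?F \<phi> s = gval ?F \<phi> t" if e: "(s, t) \<in> E" and \<phi>: "range \<phi> \<subseteq> carrier ?F" for s t \<phi>
  proof -
    have "\<exists>u. u \<in> gwords X \<and> \<phi> i = free_rel E X `` {u}" for i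
      using \<phi> by (meson rangeI rel_free_carrierE subsetD)
    then obtain \<sigma> where \<sigma>: "\<And>i. \<sigma> i \<in> gwords X" and eq: "\<phi> = (\<lambda>i. free_rel E X `` {\<sigma> i})"
      by metis
    have r: "range \<sigma> \<subseteq> gwords X" using \<sigma> by auto
    show ?thesis
      unfolding eq rel_free_gval[OF r] using free_rel.ident[OF e r]
      by (simp add: rel_free_class_eq gsubst_gwords r)
  qed
  then show ?thesis
    by (auto simp: variety_def satisfies_def rel_free_is_group)
qed

theorem rel_free_generated:
  "generate (rel_free_group E X) (rel_free_gen E X ` X) = carrier (rel_free_group E X)"
proof
  let ?F = "rel_free_group E X" and ?Y = "rel_free_gen E X ` X"
  interpret group ?F by (rule rel_free_is_group)
  have Y: "?Y \<subseteq> carrier ?F"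
    by (auto simp: rel_free_gen_def rel_free_class_in)
  then show "generate ?F ?Y \<subseteq> carrier ?F"
    by (rule generate_incl)
  have "t \<in> gwords X \<Longrightarrow> free_rel E X `` {t} \<in> generate ?F ?Y" for t
  proof (induction t)
    case (Var x)
    then show ?case by (auto simp: rel_free_gen_def intro: generate.incl)
  next
    case One
    then show ?case using generate.one[of ?F ?Y] by (simp add: rel_free_one)
  next
    case (Mul s t)
    then show ?case using generate.eng[of "free_rel E X `` {s}" ?F ?Y "free_rel E X `` {t}"]
      by (simp add: rel_free_mult)
  next
    case (Inv t)
    then show ?case using generate_m_inv_closed[OF Y, of "free_rel E X `` {t}"]
      by (simp add: rel_free_inv)
  qed
  then show "carrier ?F \<subseteq> generate ?F ?Y"
    by (auto elim!: rel_free_carrierE)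
qed

lemma gval_in_carrier:
  assumes "group G" "\<phi> ` set_gword t \<subseteq> carrier G"
  shows "gval G \<phi> t \<in> carrier G"
proof -
  interpret group G by fact
  show ?thesis using assms(2) by (induction t) auto
qed

lemma gval_gsubst: "gval G \<phi> (gsubst \<sigma> t) = gval G (\<lambda>i. gval G \<phi> (\<sigma> i)) t"
  by (induction t) simp_all

lemma free_rel_sound:
  assumes G: "G \<in> variety E" and \<phi>: "\<phi> ` X \<subseteq> carrier G" and "(s, t) \<in> free_rel E X"
  shows "gval G \<phi> s = gval G \<phi> t"
proof -
  interpret group G using G by (simp add: variety_def)
  have c: "gval G \<phi> u \<in> carrier G" if "u \<in> gwords X" for u
    using that \<phi> by (intro gval_in_carrier group_axioms) (auto simp: gwords_def)
  show ?thesis using assms(3)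
  proof (induction rule: free_rel.induct)
    case (ident s t \<sigma>)
    then have "range (\<lambda>i. gval G \<phi> (\<sigma> i)) \<subseteq> carrier G" using c by auto
    then show ?case
      using G ident by (force simp: gval_gsubst variety_def satisfies_def)
  qed (simp_all add: c m_assoc)
qed

theorem rel_free_universal:
  assumes G: "G \<in> variety E" and f: "f ` X \<subseteq> carrier G"
  shows "\<exists>h\<in>hom (rel_free_group E X) G. \<forall>x\<in>X. h (rel_free_gen E X x) = f x"
proof -
  let ?F = "rel_free_group E X"
  define h where "h A = gval G f (SOME t. t \<in> A)" for A
  have h: "h (free_rel E X `` {t}) = gval G f t" if "t \<in> gwords X" for t
  proof -
    have "t \<in> free_rel E X `` {t}" using that by (auto intro: free_rel.refl)
    then have "(t, SOME u. u \<in> free_rel E X `` {t}) \<in> free_rel E X"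
      using someI[of "\<lambda>u. u \<in> free_rel E X `` {t}" t] by simp
    then show ?thesis unfolding h_def by (rule free_rel_sound[OF G f, symmetric])
  qed
  have grp: "group G" using G by (simp add: variety_def)
  have "h \<in> hom ?F G"
  proof (rule homI)
    fix A assume "A \<in> carrier ?F"
    then obtain a where a: "a \<in> gwords X" "A = free_rel E X `` {a}" by (rule rel_free_carrierE)
    show "h A \<in> carrier G"
      using a f h by (auto simp: gwords_def intro!: gval_in_carrier grp)
    fix B assume "B \<in> carrier ?F"
    then obtain b where b: "b \<in> gwords X" "B = free_rel E X `` {b}" by (rule rel_free_carrierE)
    show "h (A \<otimes>\<^bsub>?F\<^esub> B) = h A \<otimes>\<^bsub>G\<^esub> h B"
      using a b by (simp add: rel_free_mult h)
  qed
  moreover have "\<forall>x\<in>X. h (rel_free_gen E X x) = f x"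
    by (simp add: rel_free_gen_def h)
  ultimately show ?thesis by blast
qed

theorem rel_free_gen_inj:
  assumes G: "G \<in> variety E" and nt: "carrier G \<noteq> {\<one>\<^bsub>G\<^esub>}"
  shows "inj_on (rel_free_gen E X) X"
proof (rule inj_onI, rule ccontr)
  fix x y assume xy: "x \<in> X" "y \<in> X" "rel_free_gen E X x = rel_free_gen E X y" "x \<noteq> y"
  interpret group G using G by (simp add: variety_def)
  obtain g where g: "g \<in> carrier G" "g \<noteq> \<one>\<^bsub>G\<^esub>" using nt one_closed by blast
  obtain h where "\<forall>z\<in>X. h (rel_free_gen E X z) = (if z = x then g else \<one>\<^bsub>G\<^esub>)"
    using rel_free_universal[OF G, of "\<lambda>z. if z = x then g else \<one>\<^bsub>G\<^esub>" X] g by auto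
  then show False using xy g by metis
qed


subsection \<open>Periodicity\<close>

lemma gval_hom:
  assumes "group G" "group H" "h \<in> hom G H" "range \<phi> \<subseteq> carrier G"
  shows "h (gval G \<phi> t) = gval H (h \<circ> \<phi>) t"
proof -
  interpret group_hom G H h
    using assms by (simp add: group_hom_def group_hom_axioms_def)
  have c: "gval G \<phi> u \<in> carrier G" for u
    using assms(4) by (intro gval_in_carrier assms(1)) auto
  show ?thesis by (induction t) (simp_all add: c)
qed

text \<open>A group that embeds into a member of a variety belongs to the variety.\<close>

lemma variety_embed:
  assumes H: "H \<in> variety E" and G: "group G" and h: "h \<in> hom G H" "inj_on h (carrier G)"
  shows "G \<in> variety E"
proof -
  have grp: "group H" using H by (simp add: variety_def)
  have "gval G \<phi> s = gval G \<phi> t" if "(s, t) \<in> E" "range \<phi> \<subseteq> carrier G" for s t \<phi>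
  proof (rule inj_onD[OF h(2)])
    have "range (h \<circ> \<phi>) \<subseteq> carrier H"
      using h(1) that(2) by (auto simp: hom_def)
    then have "gval H (h \<circ> \<phi>) s = gval H (h \<circ> \<phi>) t"
      using H that(1) by (fastforce simp: variety_def satisfies_def)
    then show "h (gval G \<phi> s) = h (gval G \<phi> t)"
      by (simp add: gval_hom[OF G grp h(1) that(2)])
  qed (use that G in \<open>auto intro!: gval_in_carrier\<close>)
  then show ?thesis using G by (auto simp: variety_def satisfies_def)
qed

lemma nat_copy:
  fixes K :: "('a, 'b) monoid_scheme"
  assumes K: "group K" and cnt: "countable (carrier K)"
  obtains H :: "nat monoid" and h where "group H" "h \<in> iso H K"
proof -
  interpret group K by fact
  let ?f = "to_nat_on (carrier K)" and ?g = "from_nat_into (carrier K)"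
  have gf [simp]: "?g (?f x) = x" if "x \<in> carrier K" for x
    using that cnt by simp
  define H where "H = \<lparr>carrier = ?f ` carrier K, mult = (\<lambda>a b. ?f (?g a \<otimes>\<^bsub>K\<^esub> ?g b)), one = ?f \<one>\<^bsub>K\<^esub>\<rparr>"
  have "group H"
  proof (rule groupI)
    fix a assume "a \<in> carrier H"
    then obtain x where x: "x \<in> carrier K" "a = ?f x" by (auto simp: H_def)
    show "\<exists>b\<in>carrier H. b \<otimes>\<^bsub>H\<^esub> a = \<one>\<^bsub>H\<^esub>"
      using x by (intro bexI[of _ "?f (inv\<^bsub>K\<^esub> x)"]) (auto simp: H_def)
  qed (auto simp: H_def m_assoc)
  moreover have "?g \<in> iso H K"
    by (auto simp: iso_def hom_def bij_betw_def inj_on_def H_def image_image)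
  ultimately show ?thesis by (rule that)
qed

theorem periodic_exponent:
  fixes G :: "('a, 'b) monoid_scheme" and k :: nat
  assumes ex: "\<forall>H \<in> (variety E :: nat monoid set). \<forall>y\<in>carrier H. y [^]\<^bsub>H\<^esub> k = \<one>\<^bsub>H\<^esub>"
    and G: "G \<in> variety E" and x: "x \<in> carrier G"
  shows "x [^]\<^bsub>G\<^esub> k = \<one>\<^bsub>G\<^esub>"
proof -
  interpret G: group G using G by (simp add: variety_def)
  define K where "K = G\<lparr>carrier := generate G {x}\<rparr>"
  have sub: "subgroup (generate G {x}) G" using x by (simp add: G.generate_is_subgroup)
  have K: "group K" unfolding K_def by (rule G.subgroup_imp_group[OF sub])
  have "countable (carrier K)"
    using x by (simp add: K_def G.generate_pow full_SetCompr_eq)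
  then obtain H :: "nat monoid" and h where H: "group H" "h \<in> iso H K"
    using nat_copy[OF K] by blast
  have hG: "h \<in> hom H G" "inj_on h (carrier H)"
    using H(2) subgroup.subset[OF sub] by (auto simp: iso_def hom_def K_def bij_betw_def)
  have "H \<in> variety E" by (rule variety_embed[OF G H(1) hG])
  interpret h: group_hom H G h
    using H(1) hG(1) G.group_axioms by (simp add: group_hom_def group_hom_axioms_def)
  have "x \<in> h ` carrier H"
    using H(2) by (auto simp: iso_def bij_betw_def K_def intro: generate.incl)
  then obtain y where y: "y \<in> carrier H" "x = h y" by blast
  have "x [^]\<^bsub>G\<^esub> k = h (y [^]\<^bsub>H\<^esub> k)" using y by (simp add: h.hom_nat_pow)
  also have "\<dots> = \<one>\<^bsub>G\<^esub>" using ex \<open>H \<in> variety E\<close> y by simp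
  finally show ?thesis .
qed

end

theory Submission
  imports Defs "HOL-Algebra.Multiplicative_Group"
begin

text \<open>Homomorphisms from the relatively free group on \<open>X\<close> to a finite group \<open>C\<close> of the variety are
  the maps \<open>X \<rightarrow> C\<close>, and they are determined by their values on any generating set \<open>Y\<close>. Hence
  \<open>|C| ^ |X| \<le> |C| ^ |Y|\<close>, which bounds the group rank; moreover, if \<open>|Y| = |X|\<close>, then every map
  \<open>Y \<rightarrow> C\<close> extends to a homomorphism. In the periodic case inverses are positive powers, so both
  ranks agree. In the other case every \<open>\<int>/N\<close> is in the variety. If \<open>Y\<close> generated the
  semigroup and \<open>|Y| = n\<close>, then \<open>1\<close> would be a product of \<open>l \<ge> 1\<close> elements of \<open>Y\<close>, and the
  homomorphism to \<open>\<int>/(l + 1)\<close> that maps all of \<open>Y\<close> to \<open>1\<close> would give \<open>l \<equiv> 0\<close> modulo \<open>l + 1\<close>. The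
  bound \<open>n + 1\<close> is attained by the free generators with the inverse of their product.\<close>

section \<open>Quotients in a variety and finite cyclic groups\<close>

lemma variety_image:
  assumes H: "H \<in> variety E" and G: "group G" and h: "h \<in> hom H G" "h ` carrier H = carrier G"
  shows "G \<in> variety E"
proof -
  have grp: "group H" using H by (simp add: variety_def)
  have "gval G \<phi> s = gval G \<phi> t" if e: "(s, t) \<in> E" and \<phi>: "range \<phi> \<subseteq> carrier G" for s t \<phi>
  proof -
    \<comment> \<open>Surjectivity lets the valuation \<open>\<phi>\<close> be lifted through
      \<open>h\<close>, by choosing preimages, to a valuation in \<open>H\<close>; there the
      identity holds, and \<open>h\<close> carries it back.\<close>
    define \<psi> where "\<psi> i = inv_into (carrier H) h (\<phi> i)" for i
    have \<phi>_im: "\<phi> i \<in> h ` carrier H" for i using \<phi> h(2) by blast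
    have \<psi>: "range \<psi> \<subseteq> carrier H" unfolding \<psi>_def using inv_into_into[OF \<phi>_im] by blast
    have eq: "h \<circ> \<psi> = \<phi>" unfolding \<psi>_def using f_inv_into_f[OF \<phi>_im] by (simp add: fun_eq_iff)
    have "gval H \<psi> s = gval H \<psi> t"
      using H e \<psi> by (fastforce simp: variety_def satisfies_def)
    then show ?thesis
      using gval_hom[OF grp G h(1) \<psi>] unfolding eq by metis
  qed
  then show ?thesis using G by (auto simp: variety_def satisfies_def)
qed

lemma integer_mod_group_in_variety:
  assumes "integer_group \<in> variety E" "N > 0"
  shows "integer_mod_group N \<in> variety E"
proof (rule variety_image[OF assms(1) group_integer_mod_group])
  show "(\<lambda>z. z mod int N) \<in> hom integer_group (integer_mod_group N)"
    using assms(2) by (auto simp: hom_def carrier_integer_mod_group mod_add_eq)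
  show "(\<lambda>z. z mod int N) ` carrier integer_group = carrier (integer_mod_group N)"
    using assms(2) by (auto simp: carrier_integer_mod_group) (metis mod_pos_pos_trivial rangeI)
qed

lemma integer_mod_group_nontrivial:
  assumes "N > 1"
  shows "carrier (integer_mod_group N) \<noteq> {\<one>\<^bsub>integer_mod_group N\<^esub>}"
proof
  assume "carrier (integer_mod_group N) = {\<one>\<^bsub>integer_mod_group N\<^esub>}"
  moreover have "1 \<in> carrier (integer_mod_group N)" using assms by simp
  ultimately have "(1::int) \<in> {0}" by (simp only: one_integer_mod_group)
  then show False by simp
qed

section \<open>Counting homomorphisms into a finite group\<close>

lemma hom_eq_on_generate:
  assumes "group G" "group H" "h \<in> hom G H" "h' \<in> hom G H" and Y: "Y \<subseteq> carrier G"
    and eq: "\<And>y. y \<in> Y \<Longrightarrow> h y = h' y" and g: "g \<in> generate G Y"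
  shows "h g = h' g"
proof -
  interpret h: group_hom G H h using assms by (simp add: group_hom_def group_hom_axioms_def)
  interpret h': group_hom G H h' using assms by (simp add: group_hom_def group_hom_axioms_def)
  show ?thesis using g
  proof (induction rule: generate.induct)
    case (inv y)
    then show ?case using Y eq[of y] by (auto simp: subset_iff)
  next
    case (eng a b)
    then show ?case using group.generate_in_carrier[OF assms(1) Y] by simp
  qed (use eq in simp_all)
qed

lemma rel_free_gen_closed: "rel_free_gen E X ` X \<subseteq> carrier (rel_free_group E X)"
  by (auto simp: rel_free_gen_def rel_free_class_in)

text \<open>Both conclusions come from one map \<open>r\<close>, which sends the values of a
  homomorphism on the free generators to its values on \<open>Y\<close>. Its injectivity gives the
  inequality; when the sizes agree it is also surjective, which gives the extension property.
  Extensional functions make its domain and codomain finite sets of known size.\<close>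

lemma rel_free_generating_set:
  assumes C: "C \<in> variety E" and fin: "finite (carrier C)" and nt: "carrier C \<noteq> {\<one>\<^bsub>C\<^esub>}"
    and X: "finite X" and Y: "Y \<subseteq> carrier (rel_free_group E X)" "finite Y"
    and gen: "generate (rel_free_group E X) Y = carrier (rel_free_group E X)"
  shows card_le_generating_set: "card X \<le> card Y"
    and hom_prescribed_on_generating_set:
      "card Y \<le> card X \<Longrightarrow> g ` Y \<subseteq> carrier C \<Longrightarrow>
        \<exists>h\<in>hom (rel_free_group E X) C. \<forall>y\<in>Y. h y = g y"
proof -
  let ?F = "rel_free_group E X" and ?A = "X \<rightarrow>\<^sub>E carrier C" and ?B = "Y \<rightarrow>\<^sub>E carrier C"
  have grp: "group C" using C by (simp add: variety_def)
  then interpret C: group C .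
  \<comment> \<open>With the condition on \<open>f\<close> inside the existential, choice yields a
    single total function that assigns a homomorphism to each \<open>f\<close>.\<close>
  have "\<forall>f. \<exists>h. f \<in> ?A \<longrightarrow> h \<in> hom ?F C \<and> (\<forall>x\<in>X. h (rel_free_gen E X x) = f x)"
  proof
    fix f
    show "\<exists>h. f \<in> ?A \<longrightarrow> h \<in> hom ?F C \<and> (\<forall>x\<in>X. h (rel_free_gen E X x) = f x)"
      using rel_free_universal[OF C, of f X] by (cases "f \<in> ?A") (auto simp: image_subset_iff)
  qed
  then obtain h where h: "\<And>f. f \<in> ?A \<Longrightarrow> h f \<in> hom ?F C"
    and hx: "\<And>f x. f \<in> ?A \<Longrightarrow> x \<in> X \<Longrightarrow> h f (rel_free_gen E X x) = f x"
    by metis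
  define r where "r f = restrict (h f) Y" for f
  have "inj_on r ?A"
  proof (rule inj_onI)
    fix f f' assume f: "f \<in> ?A" "f' \<in> ?A" and eq: "r f = r f'"
    have "h f y = h f' y" if "y \<in> Y" for y
      using fun_cong[OF eq, of y] that by (simp add: r_def)
    then have "h f a = h f' a" if "a \<in> carrier ?F" for a
      using hom_eq_on_generate[OF rel_free_is_group grp h[OF f(1)] h[OF f(2)] Y(1)] that gen by blast
    then have "f x = f' x" if "x \<in> X" for x
      using hx[OF f(1) that] hx[OF f(2) that] rel_free_gen_closed[of E X] that by force
    then show "f = f'" using f by (meson PiE_ext)
  qed
  moreover have sub: "r ` ?A \<subseteq> ?B"
  proof (rule image_subsetI)
    fix f assume "f \<in> ?A"
    then have "h f \<in> carrier ?F \<rightarrow> carrier C" using h by (simp add: hom_def)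
    then show "r f \<in> ?B" using Y(1) by (auto simp: r_def)
  qed
  moreover have finB: "finite ?B" using Y fin by (simp add: finite_PiE)
  ultimately have "card ?A \<le> card ?B" and cardr: "card (r ` ?A) = card ?A"
    by (rule card_inj_on_le, simp add: card_image)
  moreover have cards: "card ?A = card (carrier C) ^ card X" "card ?B = card (carrier C) ^ card Y"
    using X Y by (simp_all add: card_funcsetE)
  moreover have "card (carrier C) > 1"
  proof -
    obtain c where "c \<in> carrier C" "c \<noteq> \<one>\<^bsub>C\<^esub>" using nt C.one_closed by blast
    then have "card {c, \<one>\<^bsub>C\<^esub>} \<le> card (carrier C)" by (intro card_mono fin) auto
    then show ?thesis using \<open>c \<noteq> \<one>\<^bsub>C\<^esub>\<close> by simp
  qed
  ultimately show le: "card X \<le> card Y" by simp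
  assume "card Y \<le> card X" and g: "g ` Y \<subseteq> carrier C"
  \<comment> \<open>The image of an injective map has the size of its domain, here that of the
    finite set \<open>?B\<close>, so it is all of \<open>?B\<close>.\<close>
  then have "r ` ?A = ?B"
    using le cards cardr by (intro card_subset_eq[OF finB sub]) simp
  moreover have "restrict g Y \<in> ?B" using g by auto
  ultimately obtain f where f: "f \<in> ?A" "restrict g Y = r f" by blast
  have "h f y = g y" if "y \<in> Y" for y
    using fun_cong[OF f(2), of y] that unfolding r_def by simp
  then show "\<exists>h\<in>hom ?F C. \<forall>y\<in>Y. h y = g y"
    using h[OF f(1)] by blast
qed

section \<open>Semigroup generation inside a group\<close>

lemma (in group) semigroup_generate_subset_generate:
  assumes "Y \<subseteq> carrier G"
  shows "semigroup_generate G Y \<subseteq> generate G Y"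
proof
  fix a assume "a \<in> semigroup_generate G Y"
  then show "a \<in> generate G Y"
    by induction (auto intro: generate.incl generate.eng)
qed

lemma (in group) semigroup_generate_closed:
  "Y \<subseteq> carrier G \<Longrightarrow> semigroup_generate G Y \<subseteq> carrier G"
  using semigroup_generate_subset_generate generate_incl by blast

lemma semigroup_generate_mono:
  assumes "Y \<subseteq> Z"
  shows "semigroup_generate G Y \<subseteq> semigroup_generate G Z"
proof
  fix a assume "a \<in> semigroup_generate G Y"
  then show "a \<in> semigroup_generate G Z"
    using assms by induction (auto intro: semigroup_generate.intros)
qed

text \<open>A semigroup has to produce the identity as a product, here
  \<open>y \<otimes> inv y\<close>, so some \<open>y\<close> in \<open>Y\<close> must exist. The set
  \<open>Z\<close> may exceed \<open>Y\<close>: the periodic case takes \<open>Z = Y\<close>, the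
  integer case adds one element.\<close>

lemma (in group) semigroup_generate_eq_generate:
  assumes Y: "Y \<subseteq> carrier G" "Y \<noteq> {}" and Z: "Z \<subseteq> generate G Y" "Y \<subseteq> Z"
    and inv: "\<And>y. y \<in> Y \<Longrightarrow> inv y \<in> semigroup_generate G Z"
  shows "semigroup_generate G Z = generate G Y"
proof
  show "semigroup_generate G Z \<subseteq> generate G Y"
  proof
    fix a assume "a \<in> semigroup_generate G Z"
    then show "a \<in> generate G Y"
      using Z by induction (auto intro: generate.eng)
  qed
  show "generate G Y \<subseteq> semigroup_generate G Z"
  proof
    fix a assume "a \<in> generate G Y"
    then show "a \<in> semigroup_generate G Z"
    proof induction
      case one
      obtain y where y: "y \<in> Y" using Y by blast
      then have "y \<otimes> inv y \<in> semigroup_generate G Z"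
        using Z inv by (auto intro: semigroup_generate.intros)
      then show ?case using y Y by (auto simp: subset_iff)
    qed (use Z inv in \<open>auto intro: semigroup_generate.intros\<close>)
  qed
qed

lemma (in monoid) nat_pow_in_semigroup_generate:
  assumes "y \<in> Y" "y \<in> carrier G"
  shows "y [^] Suc m \<in> semigroup_generate G Y"
  using assms by (induction m) (auto intro: semigroup_generate.intros)

lemma (in group) inv_in_semigroup_generate:
  assumes y: "y \<in> Y" "y \<in> carrier G" and k: "y [^] k = \<one>" "k \<ge> (1::nat)"
  shows "inv y \<in> semigroup_generate G Y"
proof -
  \<comment> \<open>For \<open>k = 1\<close> the power \<open>k - 1\<close> would be an empty
    product, which a semigroup does not offer; the exponent \<open>2 * k - 1\<close> is always
    positive.\<close>
  have "y [^] (2 * k - 1) \<otimes> y = y [^] (2 * k)"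
    using k(2) by (simp flip: nat_pow_Suc)
  also have "\<dots> = \<one>" using k y(2) by (metis mult.commute nat_pow_one nat_pow_pow)
  finally have "inv y = y [^] Suc (2 * k - 2)"
    using y(2) k(2) by (simp add: inv_equality Suc_diff_Suc numeral_2_eq_2)
  then show ?thesis using nat_pow_in_semigroup_generate[OF y] by simp
qed

text \<open>Multiplying the inverse of the product by one factor, on the proper side, cancels that
  factor and leaves the inverse of the other.\<close>

lemma (in group) inv_factor_in_semigroup_generate:
  assumes Y: "Y \<subseteq> carrier G" and a: "a \<in> semigroup_generate G Y" and b: "b \<in> semigroup_generate G Y"
    and ab: "inv (a \<otimes> b) \<in> semigroup_generate G Y"
  shows "inv a \<in> semigroup_generate G Y" "inv b \<in> semigroup_generate G Y"
proof -
  have c: "a \<in> carrier G" "b \<in> carrier G" using a b semigroup_generate_closed[OF Y] by auto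
  have "inv a = b \<otimes> inv (a \<otimes> b)"
    using c by (simp add: inv_mult_group flip: m_assoc)
  moreover have "inv b = inv (a \<otimes> b) \<otimes> a"
    using c by (simp add: inv_mult_group m_assoc)
  ultimately show "inv a \<in> semigroup_generate G Y" "inv b \<in> semigroup_generate G Y"
    using a b ab by (auto intro: semigroup_generate.mult)
qed

text \<open>The witness \<open>p\<close> is the product of the elements of \<open>Y\<close> in the
  order in which finite induction adds them. Since \<open>p\<close> is fixed before
  \<open>Z\<close>, the induction hypothesis for the smaller set applies to every \<open>Z\<close>
  that contains the larger one.\<close>

lemma (in group) exists_product_inverting_factors:
  assumes "finite Y" "Y \<noteq> {}" "Y \<subseteq> carrier G"
  shows "\<exists>p\<in>semigroup_generate G Y. \<forall>Z. Y \<subseteq> Z \<longrightarrow> Z \<subseteq> carrier G \<longrightarrow>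
    inv p \<in> semigroup_generate G Z \<longrightarrow> (\<forall>y\<in>Y. inv y \<in> semigroup_generate G Z)"
  using assms
proof (induction rule: finite_ne_induct)
  case (singleton y)
  then show ?case by (auto intro: semigroup_generate.incl)
next
  case (insert y Y)
  then obtain p where p: "p \<in> semigroup_generate G Y"
    and inv: "\<And>Z. Y \<subseteq> Z \<Longrightarrow> Z \<subseteq> carrier G \<Longrightarrow> inv p \<in> semigroup_generate G Z
      \<Longrightarrow> \<forall>y\<in>Y. inv y \<in> semigroup_generate G Z"
    by auto
  have "y \<otimes> p \<in> semigroup_generate G (insert y Y)"
    using p semigroup_generate_mono[of Y "insert y Y"] by (auto intro: semigroup_generate.intros)
  moreover have "\<forall>x\<in>insert y Y. inv x \<in> semigroup_generate G Z"
    if Z: "insert y Y \<subseteq> Z" "Z \<subseteq> carrier G" "inv (y \<otimes> p) \<in> semigroup_generate G Z" for Z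
  proof -
    have "y \<in> semigroup_generate G Z" "p \<in> semigroup_generate G Z"
      using p Z(1) semigroup_generate_mono[of Y Z] by (auto intro: semigroup_generate.incl)
    from inv_factor_in_semigroup_generate[OF Z(2) this Z(3)] show ?thesis
      using inv[of Z] Z by auto
  qed
  ultimately show ?case by blast
qed

text \<open>The number \<open>l\<close> is the length of some product of elements of
  \<open>Y\<close> that equals \<open>a\<close>; other products may have other lengths. It is fixed
  before \<open>N\<close> and \<open>h\<close>, so that the modulus can later be chosen in terms of
  \<open>l\<close>.\<close>

lemma semigroup_generate_hom_length:
  assumes F: "group F" and Y: "Y \<subseteq> carrier F" and a: "a \<in> semigroup_generate F Y"
  shows "\<exists>l\<ge>1. \<forall>N>1. \<forall>h\<in>hom F (integer_mod_group N). (\<forall>y\<in>Y. h y = 1) \<longrightarrow> h a = int l mod int N"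
  using a
proof induction
  case (incl y)
  then show ?case by (intro exI[of _ 1]) auto
next
  case (mult a b)
  then obtain l m where l: "l \<ge> 1" "\<forall>N>1. \<forall>h\<in>hom F (integer_mod_group N). (\<forall>y\<in>Y. h y = 1) \<longrightarrow> h a = int l mod int N"
    and m: "\<forall>N>1. \<forall>h\<in>hom F (integer_mod_group N). (\<forall>y\<in>Y. h y = 1) \<longrightarrow> h b = int m mod int N"
    by blast
  have c: "a \<in> carrier F" "b \<in> carrier F"
    using mult group.semigroup_generate_closed[OF F Y] by auto
  show ?case
  proof (intro exI[of _ "l + m"] conjI allI impI ballI)
    fix N :: nat and h assume N: "N > 1" and h: "h \<in> hom F (integer_mod_group N)" "\<forall>y\<in>Y. h y = 1"
    have "h (a \<otimes>\<^bsub>F\<^esub> b) = (h a + h b) mod int N"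
      using hom_mult[OF h(1) c] by simp
    moreover have "h a = int l mod int N" "h b = int m mod int N"
      using l(2) m N h by blast+
    ultimately show "h (a \<otimes>\<^bsub>F\<^esub> b) = int (l + m) mod int N"
      by (simp add: mod_add_eq)
  qed (use l in simp)
qed

section \<open>The ranks of relatively free groups\<close>

lemma group_rank_eqI:
  assumes "Y \<subseteq> carrier G" "finite Y" "card Y \<le> n" "generate G Y = carrier G"
    and "\<And>Z. Z \<subseteq> carrier G \<Longrightarrow> finite Z \<Longrightarrow> generate G Z = carrier G \<Longrightarrow> n \<le> card Z"
  shows "group_rank G = n"
proof -
  \<comment> \<open>The last premise, applied to \<open>Y\<close> itself, gives
    \<open>n \<le> card Y\<close>. So for the free generators the bound on the size of an image
    suffices.\<close>
  have "card Y = n" using assms by (simp add: le_antisym)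
  then show ?thesis
    unfolding group_rank_def using assms by (intro Least_equality) blast+
qed

lemma semigroup_rank_eqI:
  assumes "Y \<subseteq> carrier G" "finite Y" "card Y \<le> n" "semigroup_generate G Y = carrier G"
    and "\<And>Z. Z \<subseteq> carrier G \<Longrightarrow> finite Z \<Longrightarrow> semigroup_generate G Z = carrier G \<Longrightarrow> n \<le> card Z"
  shows "semigroup_rank G = n"
proof -
  have "card Y = n" using assms by (simp add: le_antisym)
  then show ?thesis
    unfolding semigroup_rank_def using assms by (intro Least_equality) blast+
qed

lemma (in group) generate_eq_carrier_if_semigroup_generate:
  assumes "Y \<subseteq> carrier G" "semigroup_generate G Y = carrier G"
  shows "generate G Y = carrier G"
  using semigroup_generate_subset_generate[OF assms(1)] generate_incl[OF assms(1)] assms(2) by simp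

lemma rel_free_group_rank:
  assumes "C \<in> variety E" "finite (carrier C)" "carrier C \<noteq> {\<one>\<^bsub>C\<^esub>}" "finite X"
  shows "group_rank (rel_free_group E X) = card X"
proof (rule group_rank_eqI[OF rel_free_gen_closed _ _ rel_free_generated])
  show "card X \<le> card Z" if "Z \<subseteq> carrier (rel_free_group E X)" "finite Z"
    "generate (rel_free_group E X) Z = carrier (rel_free_group E X)" for Z
    by (rule card_le_generating_set[OF assms that])
qed (use assms(4) in \<open>simp_all add: card_image_le\<close>)

text \<open>A nontrivial element has finite order by periodicity, and the cyclic group it generates
  embeds in \<open>G\<close>. This supplies the finite group for the counting argument.\<close>

lemma finite_variety_member:
  assumes "periodic E" and G: "G \<in> variety E" "carrier G \<noteq> {\<one>\<^bsub>G\<^esub>}"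
  obtains g where "subgroup_generated G {g} \<in> variety E" "finite (carrier (subgroup_generated G {g}))"
    "carrier (subgroup_generated G {g}) \<noteq> {\<one>\<^bsub>subgroup_generated G {g}\<^esub>}"
proof -
  interpret group G using G by (simp add: variety_def)
  obtain g where g: "g \<in> carrier G" "g \<noteq> \<one>\<^bsub>G\<^esub>" using G(2) one_closed by blast
  obtain k where k: "k \<ge> (1::nat)"
    "\<forall>H\<in>(variety E :: nat monoid set). \<forall>x\<in>carrier H. x [^]\<^bsub>H\<^esub> k = \<one>\<^bsub>H\<^esub>"
    using assms(1) unfolding periodic_def by blast
  let ?C = "subgroup_generated G {g}"
  have "?C \<in> variety E"
    by (rule variety_embed[OF G(1), where h = id])
       (auto simp: hom_def intro: subsetD[OF carrier_subgroup_generated_subset])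
  moreover have "finite (carrier ?C)"
    using periodic_exponent[OF k(2) G(1) g(1)] k(1) g(1) finite_cyclic_subgroup[OF g(1)]
    by (metis not_one_le_zero)
  moreover have "g \<in> carrier ?C"
    using g by (simp add: carrier_subgroup_generated generate.incl)
  ultimately show ?thesis using g(2) by (intro that[of g]) auto
qed

lemma rel_free_semigroup_rank_periodic:
  assumes per: "periodic E" and C: "C \<in> variety E" "finite (carrier C)" "carrier C \<noteq> {\<one>\<^bsub>C\<^esub>}"
    and X: "finite X" "X \<noteq> {}"
  shows "semigroup_rank (rel_free_group E X) = card X"
proof -
  let ?F = "rel_free_group E X" and ?Y = "rel_free_gen E X ` X"
  interpret group ?F by (rule rel_free_is_group)
  obtain k where k: "k \<ge> (1::nat)"
    "\<forall>H\<in>(variety E :: nat monoid set). \<forall>x\<in>carrier H. x [^]\<^bsub>H\<^esub> k = \<one>\<^bsub>H\<^esub>"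
    using per unfolding periodic_def by blast
  have "semigroup_generate ?F ?Y = generate ?F ?Y"
  proof (rule semigroup_generate_eq_generate)
    show "?Y \<subseteq> carrier ?F" by (rule rel_free_gen_closed)
    show "?Y \<noteq> {}" using X by simp
    show "?Y \<subseteq> generate ?F ?Y" using rel_free_gen_closed by (simp add: rel_free_generated)
    show "?Y \<subseteq> ?Y" by (rule subset_refl)
    fix y assume y: "y \<in> ?Y"
    then have y': "y \<in> carrier ?F" by (rule subsetD[OF rel_free_gen_closed])
    have "y [^]\<^bsub>?F\<^esub> k = \<one>\<^bsub>?F\<^esub>"
      by (rule periodic_exponent[OF k(2) rel_free_in_variety y'])
    then show "inv\<^bsub>?F\<^esub> y \<in> semigroup_generate ?F ?Y"
      by (rule inv_in_semigroup_generate[OF y y' _ k(1)])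
  qed
  then have gen: "semigroup_generate ?F ?Y = carrier ?F" by (simp add: rel_free_generated)
  show ?thesis
  proof (rule semigroup_rank_eqI[OF rel_free_gen_closed _ _ gen])
    fix Z assume Z: "Z \<subseteq> carrier ?F" "finite Z" "semigroup_generate ?F Z = carrier ?F"
    show "card X \<le> card Z"
      using generate_eq_carrier_if_semigroup_generate[OF Z(1,3)]
      by (rule card_le_generating_set[OF C X(1) Z(1,2)])
  qed (use X in \<open>simp_all add: card_image_le\<close>)
qed

lemma rel_free_semigroup_rank_integer:
  assumes Z: "integer_group \<in> variety E" and X: "finite X" "X \<noteq> {}"
  shows "semigroup_rank (rel_free_group E X) = card X + 1"
proof -
  let ?F = "rel_free_group E X" and ?Y = "rel_free_gen E X ` X"
  interpret group ?F by (rule rel_free_is_group)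
  have Y: "?Y \<subseteq> carrier ?F" by (rule rel_free_gen_closed)
  obtain p where p: "p \<in> semigroup_generate ?F ?Y"
    and inv: "\<And>Z. ?Y \<subseteq> Z \<Longrightarrow> Z \<subseteq> carrier ?F \<Longrightarrow> inv\<^bsub>?F\<^esub> p \<in> semigroup_generate ?F Z
      \<Longrightarrow> \<forall>y\<in>?Y. inv\<^bsub>?F\<^esub> y \<in> semigroup_generate ?F Z"
    using exists_product_inverting_factors[of ?Y] X Y by auto
  let ?Z = "insert (inv\<^bsub>?F\<^esub> p) ?Y"
  have Zc: "?Z \<subseteq> carrier ?F" using p Y semigroup_generate_closed[OF Y] by auto
  have gen: "semigroup_generate ?F ?Z = carrier ?F"
    unfolding rel_free_generated[symmetric]
  proof (rule semigroup_generate_eq_generate[OF Y])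
    show "?Z \<subseteq> generate ?F ?Y" using Zc by (simp add: rel_free_generated)
    show "inv\<^bsub>?F\<^esub> y \<in> semigroup_generate ?F ?Z" if "y \<in> ?Y" for y
      using inv[OF subset_insertI Zc semigroup_generate.incl[OF insertI1]] that by (rule bspec)
  qed (use X in auto)
  show ?thesis
  proof (rule semigroup_rank_eqI[OF Zc _ _ gen])
    show "card ?Z \<le> card X + 1"
      using X card_insert_le_m1 card_image_le[OF X(1), of "rel_free_gen E X"]
      by (simp add: card_insert_if)
    fix W assume W: "W \<subseteq> carrier ?F" "finite W" and sW: "semigroup_generate ?F W = carrier ?F"
    have gW: "generate ?F W = carrier ?F"
      by (rule generate_eq_carrier_if_semigroup_generate[OF W(1) sW])
    show "card X + 1 \<le> card W"
    proof (rule ccontr)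
      assume "\<not> ?thesis"
      then have le: "card W \<le> card X" by simp
      \<comment> \<open>The semigroup is the whole group, so the identity itself is a product of
        \<open>l\<close> elements of \<open>W\<close>.\<close>
      obtain l where l: "l \<ge> 1" "\<forall>N>1. \<forall>h\<in>hom ?F (integer_mod_group N).
          (\<forall>y\<in>W. h y = 1) \<longrightarrow> h \<one>\<^bsub>?F\<^esub> = int l mod int N"
        using semigroup_generate_hom_length[OF is_group W(1), of "\<one>\<^bsub>?F\<^esub>"] sW by auto
      let ?C = "integer_mod_group (Suc l)"
      have C: "?C \<in> variety E" "finite (carrier ?C)" and one: "1 \<in> carrier ?C"
        using integer_mod_group_in_variety[OF Z, of "Suc l"] l(1)
        by (auto simp: carrier_integer_mod_group)
      have nt: "carrier ?C \<noteq> {\<one>\<^bsub>?C\<^esub>}"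
        using l(1) by (intro integer_mod_group_nontrivial) simp
      have "(\<lambda>_. 1) ` W \<subseteq> carrier ?C" using one by blast
      then obtain h where h: "h \<in> hom ?F ?C" "\<forall>y\<in>W. h y = 1"
        using hom_prescribed_on_generating_set[OF C nt X(1) W gW le] by blast
      moreover have "Suc l > 1" using l(1) by simp
      ultimately have "h \<one>\<^bsub>?F\<^esub> = int l mod int (Suc l)" using l(2) by blast
      moreover have "h \<one>\<^bsub>?F\<^esub> = 0"
        using hom_one[OF h(1) is_group group_integer_mod_group] by (simp add: one_integer_mod_group)
      \<comment> \<open>As \<open>1 \<le> l < Suc l\<close>, the residue of \<open>l\<close> is
        \<open>l\<close> itself and not 0.\<close>
      ultimately show False using l(1) by (simp flip: of_nat_mod)
    qed
  qed (use X in simp)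
qed

theorem theorem3p3:
  fixes E :: "identity set" and G :: "('g, 'r) monoid_scheme" and X :: "'x set" and n :: nat
  assumes "G \<in> variety E" and "carrier G \<noteq> {\<one>\<^bsub>G\<^esub>}"
    and "n \<ge> 1" and "finite X" and "card X = n"
  shows "(periodic E \<longrightarrow>
            semigroup_rank (rel_free_group E X) = group_rank (rel_free_group E X) \<and>
            group_rank (rel_free_group E X) = n) \<and>
         (integer_group \<in> variety E \<longrightarrow>
            semigroup_rank (rel_free_group E X) = group_rank (rel_free_group E X) + 1 \<and>
            group_rank (rel_free_group E X) + 1 = n + 1)"
proof -
  have X: "X \<noteq> {}" using assms by auto
  show ?thesis
  proof (rule conjI; rule impI)
    assume per: "periodic E"
    obtain g where C: "subgroup_generated G {g} \<in> variety E"
      "finite (carrier (subgroup_generated G {g}))"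
      "carrier (subgroup_generated G {g}) \<noteq> {\<one>\<^bsub>subgroup_generated G {g}\<^esub>}"
      using finite_variety_member[OF per assms(1,2)] .
    show "semigroup_rank (rel_free_group E X) = group_rank (rel_free_group E X) \<and>
        group_rank (rel_free_group E X) = n"
      using rel_free_semigroup_rank_periodic[OF per C \<open>finite X\<close> X]
        rel_free_group_rank[OF C \<open>finite X\<close>] assms(5) by simp
  next
    assume Z: "integer_group \<in> variety E"
    \<comment> \<open>The group rank can be counted with any finite nontrivial member of the
      variety; \<int>/2 is one, as a quotient of \<int>.\<close>
    have "carrier (integer_mod_group 2) \<noteq> {\<one>\<^bsub>integer_mod_group 2\<^esub>}"
      by (rule integer_mod_group_nontrivial) simp
    moreover have "finite (carrier (integer_mod_group 2))"
      by (simp add: carrier_integer_mod_group)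
    ultimately show "semigroup_rank (rel_free_group E X) = group_rank (rel_free_group E X) + 1 \<and>
        group_rank (rel_free_group E X) + 1 = n + 1"
      using rel_free_semigroup_rank_integer[OF Z \<open>finite X\<close> X] assms(5)
        rel_free_group_rank[OF integer_mod_group_in_variety[OF Z, of 2] _ _ \<open>finite X\<close>] by simp
  qed
qed

end
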